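(* Let $n\ge 1$ and let $(\tau_\mu)$ be complex numbers indexed by the horizontal tableaux $\mu$ of shape $\mathbf{2\times n}$ such that $\sum_{\mu\perp\nu}\tau_\mu=0$ for every vertical tableau $\nu$ of shape $\mathbf{2\times n}$. Then for every integer $a$ with $n/2\le a\le n$, we have $\sum_{\mu\in T_a}\tau_\mu=0$, where $T_a$ is the set of horizontal tableaux of type $a$.
   Context: A horizontal tableau of shape $\mathbf{2\times n}$ is an unordered partition of $\{1,\dots,2n\}$ into two $n$-element sets (its rows). A vertical tableau of shape $\mathbf{2\times n}$ is a partition of $\{1,\dots,2n\}$ into $n$ two-element sets (its columns). A horizontal tableau $\mu$ and a vertical tableau $\nu$ are orthogonal, $\mu\perp\nu$, if every row of $\mu$ meets every column of $\nu$ in at most one element. For a horizontal tableau $\mu$, let $a_\mu\ge b_\mu$ be the numbers of elements of $\{1,\dots,n\}$ lying in the two rows of $\mu$ (so $a_\mu+b_\mu=n$); $\mu$ is said to be of type $a$ if $a_\mu=a$. *)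

theory Defs
  imports Complex_Main "HOL-Library.Disjoint_Sets"
begin

text \<open>A tableau of either kind is the set of its blocks (rows, respectively columns), so that it
  is unordered.\<close>

definition horizontal_tableaux :: "nat \<Rightarrow> nat set set set" where
  "horizontal_tableaux n =
     {\<mu>. partition_on {1..2 * n} \<mu> \<and> card \<mu> = 2 \<and> (\<forall>R\<in>\<mu>. card R = n)}"

definition vertical_tableaux :: "nat \<Rightarrow> nat set set set" where
  "vertical_tableaux n =
     {\<nu>. partition_on {1..2 * n} \<nu> \<and> card \<nu> = n \<and> (\<forall>C\<in>\<nu>. card C = 2)}"

definition orthogonal_tableaux :: "nat set set \<Rightarrow> nat set set \<Rightarrow> bool" (infix "\<bottom>\<^sub>t" 50) where
  "\<mu> \<bottom>\<^sub>t \<nu> \<longleftrightarrow> (\<forall>R\<in>\<mu>. \<forall>C\<in>\<nu>. card (R \<inter> C) \<le> 1)"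

text \<open>The larger of the two numbers of elements of \<open>{1..n}\<close> in the two rows.\<close>

definition tableau_type :: "nat \<Rightarrow> nat set set \<Rightarrow> nat" where
  "tableau_type n \<mu> = Max ((\<lambda>R. card (R \<inter> {1..n})) ` \<mu>)"

definition tableaux_of_type :: "nat \<Rightarrow> nat \<Rightarrow> nat set set set" where
  "tableaux_of_type n a = {\<mu> \<in> horizontal_tableaux n. tableau_type n \<mu> = a}"

end

theory Submission
  imports Defs "HOL-Combinatorics.Permutations"
begin

text \<open>Let \<open>A = {1..n}\<close>. Summing the hypothesis over all vertical tableaux with exactly \<open>k\<close> columns
  inside \<open>A\<close> gives \<open>\<Sum>\<mu>. N k \<mu> * \<tau> \<mu> = 0\<close>, where \<open>N k \<mu>\<close> counts those of them that are orthogonal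
  to \<open>\<mu>\<close>. By symmetry under the permutations preserving \<open>A\<close>, \<open>N k \<mu>\<close> depends only on the type of
  \<open>\<mu>\<close>. A column inside \<open>A\<close> orthogonal to \<open>\<mu>\<close> meets both rows, so \<open>N k \<mu> = 0\<close> if \<open>\<mu>\<close> has type
  \<open>> n - k\<close>, while \<open>N k \<mu> > 0\<close> for type \<open>n - k\<close>. The resulting linear system for the sums over the
  types is therefore triangular with nonzero diagonal.\<close>

section \<open>Vertical tableaux with \<open>k\<close> inner columns, and the rows of a tableau of
  given type\<close>

definition vertical_tableaux_inner :: "nat \<Rightarrow> nat \<Rightarrow> nat set set set" where
  "vertical_tableaux_inner n k = {\<nu> \<in> vertical_tableaux n. card {C\<in>\<nu>. C \<subseteq> {1..n}} = k}"

lemma finite_horizontal_tableaux: "finite (horizontal_tableaux n)"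
proof (rule finite_subset)
  show "horizontal_tableaux n \<subseteq> Pow (Pow {1..2*n})"
    unfolding horizontal_tableaux_def partition_on_def by blast
qed simp

lemma finite_vertical_tableaux: "finite (vertical_tableaux n)"
proof (rule finite_subset)
  show "vertical_tableaux n \<subseteq> Pow (Pow {1..2*n})"
    unfolding vertical_tableaux_def partition_on_def by blast
qed simp

lemma finite_vertical_tableaux_inner: "finite (vertical_tableaux_inner n k)"
  unfolding vertical_tableaux_inner_def using finite_vertical_tableaux by simp

text \<open>Tableaux are unordered, so this fixes an order once and for all: \<open>R\<close> is a
  row attaining the maximum in \<open>tableau_type\<close>, and \<open>S\<close> is the other
  one.\<close>

lemma tableaux_of_type_rows:
  assumes "\<mu> \<in> tableaux_of_type n a"
  obtains R S where "\<mu> = {R, S}" "R \<inter> S = {}" "R \<union> S = {1..2*n}" "card R = n" "card S = n"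
    "card (R \<inter> {1..n}) = a" "card (S \<inter> {1..n}) = n - a" "a \<le> n" "n - a \<le> a"
proof -
  have part: "partition_on {1..2*n} \<mu>" and c2: "card \<mu> = 2" and cR: "\<forall>R\<in>\<mu>. card R = n"
    and ty: "tableau_type n \<mu> = a"
    using assms unfolding tableaux_of_type_def horizontal_tableaux_def by auto
  obtain P Q where PQ: "\<mu> = {P, Q}" "P \<noteq> Q"
    using c2 by (auto simp: card_2_iff)
  note result = that
  \<comment> \<open>The argument for rows already in the right order; the final case split applies
    it to \<open>P, Q\<close> or to \<open>Q, P\<close>.\<close>
  have *: thesis if "\<mu> = {R, S}" "R \<noteq> S" "card (S \<inter> {1..n}) \<le> card (R \<inter> {1..n})" for R S
  proof -
    have dj: "R \<inter> S = {}" and un: "R \<union> S = {1..2*n}"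
      using part that unfolding partition_on_def disjoint_def by auto
    have a: "card (R \<inter> {1..n}) = a"
      using ty that unfolding tableau_type_def by simp
    have "card (R \<inter> {1..n}) + card (S \<inter> {1..n}) = card ((R \<inter> {1..n}) \<union> (S \<inter> {1..n}))"
      using dj by (subst card_Un_disjoint) auto
    also have "(R \<inter> {1..n}) \<union> (S \<inter> {1..n}) = {1..n}"
    proof -
      have "{1..n} \<subseteq> R \<union> S" unfolding un by auto
      then show ?thesis by blast
    qed
    finally have sum: "card (R \<inter> {1..n}) + card (S \<inter> {1..n}) = n" by simp
    show thesis
    proof (rule result[OF that(1) dj un _ _ a])
      show "card R = n" "card S = n" using cR that(1) by blast+
    qed (use sum a that(3) in linarith)+
  qed
  show thesis
  proof (cases "card (Q \<inter> {1..n}) \<le> card (P \<inter> {1..n})")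
    case True
    then show ?thesis using * PQ by blast
  next
    case False
    then have "card (P \<inter> {1..n}) \<le> card (Q \<inter> {1..n})" by simp
    moreover have "\<mu> = {Q, P}" using PQ(1) by blast
    ultimately show ?thesis using * PQ(2) by blast
  qed
qed

section \<open>Symmetry: the number of orthogonal tableaux depends only on the type\<close>

lemma permutes_vertical_tableaux_inner:
  assumes \<sigma>: "\<sigma> permutes {1..2*n}" and A: "\<sigma> ` {1..n} = {1..n}"
    and \<nu>: "\<nu> \<in> vertical_tableaux_inner n k"
  shows "(`) \<sigma> ` \<nu> \<in> vertical_tableaux_inner n k"
proof -
  have inj: "inj \<sigma>" using \<sigma> by (rule permutes_inj)
  have part: "partition_on {1..2*n} \<nu>" and cn: "card \<nu> = n" and c2: "\<And>C. C \<in> \<nu> \<Longrightarrow> card C = 2"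
    and k: "card {C\<in>\<nu>. C \<subseteq> {1..n}} = k"
    using \<nu> unfolding vertical_tableaux_inner_def vertical_tableaux_def by auto
  have injI: "inj_on ((`) \<sigma>) X" for X
    using inj by (simp add: inj_on_def inj_image_eq_iff)
  have "partition_on (\<sigma> ` {1..2*n}) ((`) \<sigma> ` \<nu> - {{}})"
    using part inj by (intro partition_on_inj_image) (auto intro: inj_on_subset)
  \<comment> \<open>\<open>partition_on_inj_image\<close> discards empty blocks; a partition has
    none, so nothing is lost.\<close>
  moreover have "(`) \<sigma> ` \<nu> - {{}} = (`) \<sigma> ` \<nu>"
    using part unfolding partition_on_def by auto
  ultimately have "partition_on {1..2*n} ((`) \<sigma> ` \<nu>)"
    using \<sigma> by (simp add: permutes_image)
  moreover have "card ((`) \<sigma> ` \<nu>) = n"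
    using cn injI by (simp add: card_image)
  moreover have "card C = 2" if "C \<in> (`) \<sigma> ` \<nu>" for C
    using that c2 inj by (auto simp: card_image inj_on_subset)
  moreover have "{C \<in> (`) \<sigma> ` \<nu>. C \<subseteq> {1..n}} = (`) \<sigma> ` {C\<in>\<nu>. C \<subseteq> {1..n}}"
  proof -
    have "\<sigma> ` C \<subseteq> {1..n} \<longleftrightarrow> C \<subseteq> {1..n}" for C
      using inj_image_subset_iff[OF inj, of C "{1..n}"] A by simp
    then show ?thesis by auto
  qed
  then have "card {C \<in> (`) \<sigma> ` \<nu>. C \<subseteq> {1..n}} = k"
    using k injI by (simp add: card_image)
  ultimately show ?thesis
    unfolding vertical_tableaux_inner_def vertical_tableaux_def by auto
qed

lemma orthogonal_tableaux_image:
  assumes "inj \<sigma>" "\<mu> \<bottom>\<^sub>t \<nu>"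
  shows "(`) \<sigma> ` \<mu> \<bottom>\<^sub>t (`) \<sigma> ` \<nu>"
  unfolding orthogonal_tableaux_def
proof (clarify)
  fix R C assume "R \<in> \<mu>" "C \<in> \<nu>"
  have "card (\<sigma> ` R \<inter> \<sigma> ` C) = card (R \<inter> C)"
    using assms(1) by (simp flip: image_Int add: card_image inj_on_subset)
  then show "card (\<sigma> ` R \<inter> \<sigma> ` C) \<le> 1"
    using assms(2) \<open>R \<in> \<mu>\<close> \<open>C \<in> \<nu>\<close> unfolding orthogonal_tableaux_def by simp
qed

text \<open>A row and \<open>{1..n}\<close> cut \<open>{1..2*n}\<close> into four cells whose sizes
  are determined by \<open>n\<close> and \<open>a\<close>. Mapping cells to cells of equal size
  gives the permutation.\<close>

lemma tableaux_of_same_type_permutes: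
  assumes "\<mu> \<in> tableaux_of_type n a" "\<mu>' \<in> tableaux_of_type n a"
  obtains \<sigma> where "\<sigma> permutes {1..2*n}" "\<sigma> ` {1..n} = {1..n}" "(`) \<sigma> ` \<mu> = \<mu>'"
proof -
  obtain R S where \<mu>: "\<mu> = {R, S}" and RS: "R \<inter> S = {}" "R \<union> S = {1..2*n}" "card R = n" "card S = n"
    "card (R \<inter> {1..n}) = a" "card (S \<inter> {1..n}) = n - a"
    using tableaux_of_type_rows[OF assms(1)] by metis
  obtain R' S' where \<mu>': "\<mu>' = {R', S'}" and RS': "R' \<inter> S' = {}" "R' \<union> S' = {1..2*n}"
    "card R' = n" "card S' = n" "card (R' \<inter> {1..n}) = a" "card (S' \<inter> {1..n}) = n - a"
    using tableaux_of_type_rows[OF assms(2)] by metis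
  \<comment> \<open>\<open>p X x\<close> names the cell of \<open>x\<close>: its membership in the
    row \<open>X\<close> and in \<open>{1..n}\<close>.\<close>
  define p where "p = (\<lambda>X (x::nat). (x \<in> X, x \<in> {1..n}))"
  \<comment> \<open>The last size is kept as the complement of \<open>Y \<inter> {1..n}\<close> in
    \<open>Y\<close>; it only has to be the same expression for both tableaux.\<close>
  have count: "card {x \<in> {1..2*n}. p X x = c} =
      (case c of (True, True) \<Rightarrow> a | (True, False) \<Rightarrow> n - a | (False, True) \<Rightarrow> n - a
        | (False, False) \<Rightarrow> n - (n - a))"
    if XY: "X \<inter> Y = {}" "X \<union> Y = {1..2*n}" "card X = n" "card Y = n"
    "card (X \<inter> {1..n}) = a" "card (Y \<inter> {1..n}) = n - a" for X Y c
  proof -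
    have fin: "finite X" "finite Y"
      using XY(2) by (metis finite_Un finite_atLeastAtMost)+
    have "{x \<in> {1..2*n}. p X x = (True, True)} = X \<inter> {1..n}"
      "{x \<in> {1..2*n}. p X x = (True, False)} = X - X \<inter> {1..n}"
      "{x \<in> {1..2*n}. p X x = (False, True)} = Y \<inter> {1..n}"
      "{x \<in> {1..2*n}. p X x = (False, False)} = Y - Y \<inter> {1..n}"
      unfolding p_def XY(2)[symmetric] using XY(1) by auto
    moreover have "card (X - X \<inter> {1..n}) = n - a" "card (Y - Y \<inter> {1..n}) = n - (n - a)"
      using XY fin by (simp_all add: card_Diff_subset)
    ultimately show ?thesis
      using XY by (cases c; cases "fst c"; cases "snd c") auto
  qed
  \<comment> \<open>Equal cell sizes mean that \<open>p R\<close> and \<open>p R'\<close> take each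
    value equally often, hence differ by a permutation of the domain.\<close>
  have "image_mset (p R) (mset_set {1..2*n}) = image_mset (p R') (mset_set {1..2*n})"
  proof (rule multiset_eqI)
    fix c
    have "card {x \<in> {1..2*n}. p R x = c} = card {x \<in> {1..2*n}. p R' x = c}"
      using count[OF RS] count[OF RS'] by simp
    then show "count (image_mset (p R) (mset_set {1..2*n})) c =
        count (image_mset (p R') (mset_set {1..2*n})) c"
      by (simp add: count_image_mset_eq_card_vimage)
  qed
  then obtain \<sigma> where \<sigma>: "\<sigma> permutes {1..2*n}" and eq: "\<forall>x\<in>{1..2*n}. p R x = p R' (\<sigma> x)"
    using image_mset_eq_implies_permutes[of "{1..2*n}" "p R" "p R'"] by auto
  have transfer: "\<sigma> ` X = X'"
    if "X \<subseteq> {1..2*n}" "X' \<subseteq> {1..2*n}" "\<And>x. x \<in> {1..2*n} \<Longrightarrow> x \<in> X \<longleftrightarrow> \<sigma> x \<in> X'" for X X'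
  proof
    show "\<sigma> ` X \<subseteq> X'" using that by blast
    show "X' \<subseteq> \<sigma> ` X"
    proof
      fix y assume y: "y \<in> X'"
      then have "y \<in> \<sigma> ` {1..2*n}" using that(2) \<sigma> by (auto simp: permutes_image)
      then show "y \<in> \<sigma> ` X" using that(3) y by blast
    qed
  qed
  have R: "x \<in> R \<longleftrightarrow> \<sigma> x \<in> R'" and A: "x \<in> {1..n} \<longleftrightarrow> \<sigma> x \<in> {1..n}" if "x \<in> {1..2*n}" for x
    using bspec[OF eq that] unfolding p_def by blast+
  \<comment> \<open>The second rows follow as the complements of the first ones.\<close>
  have S: "x \<in> S \<longleftrightarrow> \<sigma> x \<in> S'" if "x \<in> {1..2*n}" for x
  proof -
    have "\<sigma> x \<in> {1..2*n}" using \<sigma> that by (simp only: permutes_in_image)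
    then show ?thesis using R[OF that] that RS(1,2) RS'(1,2) by blast
  qed
  have "\<sigma> ` R = R'" using RS(2) RS'(2) R by (intro transfer) auto
  moreover have "\<sigma> ` S = S'" using RS(2) RS'(2) S by (intro transfer) auto
  moreover have "\<sigma> ` {1..n} = {1..n}" using A by (intro transfer) auto
  ultimately show thesis using that \<sigma> \<mu> \<mu>' by simp
qed

text \<open>The permutation taking \<mu> to \<mu>' maps one counted set injectively into the other.
  Exchanging \<mu> and \<mu>' later turns this into an equality.\<close>

lemma card_orthogonal_inner_le:
  assumes "\<mu> \<in> tableaux_of_type n a" "\<mu>' \<in> tableaux_of_type n a"
  shows "card {\<nu> \<in> vertical_tableaux_inner n k. \<mu> \<bottom>\<^sub>t \<nu>}
       \<le> card {\<nu> \<in> vertical_tableaux_inner n k. \<mu>' \<bottom>\<^sub>t \<nu>}"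
proof -
  obtain \<sigma> where \<sigma>: "\<sigma> permutes {1..2*n}" "\<sigma> ` {1..n} = {1..n}" "(`) \<sigma> ` \<mu> = \<mu>'"
    using tableaux_of_same_type_permutes[OF assms] .
  have inj: "inj \<sigma>" using \<sigma>(1) by (rule permutes_inj)
  show ?thesis
  proof (rule card_inj_on_le)
    show "inj_on ((`) ((`) \<sigma>)) {\<nu> \<in> vertical_tableaux_inner n k. \<mu> \<bottom>\<^sub>t \<nu>}"
      using inj by (simp add: inj_on_def inj_image_eq_iff)
    show "(`) ((`) \<sigma>) ` {\<nu> \<in> vertical_tableaux_inner n k. \<mu> \<bottom>\<^sub>t \<nu>}
        \<subseteq> {\<nu> \<in> vertical_tableaux_inner n k. \<mu>' \<bottom>\<^sub>t \<nu>}"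
      using permutes_vertical_tableaux_inner[OF \<sigma>(1,2)] orthogonal_tableaux_image[OF inj] \<sigma>(3)
      by blast
  qed (simp add: finite_vertical_tableaux_inner)
qed

section \<open>Triangularity: vanishing above the diagonal type and positivity on it\<close>

text \<open>An inner column has two elements, at most one of them in \<open>R\<close>, so it meets
  \<open>S\<close>. Columns are disjoint, so the inner ones use up distinct elements of
  \<open>S \<inter> {1..n}\<close>, which has only \<open>n - a\<close>.\<close>

lemma inner_columns_le:
  assumes "\<mu> \<in> tableaux_of_type n a" "\<nu> \<in> vertical_tableaux_inner n k" "\<mu> \<bottom>\<^sub>t \<nu>"
  shows "k \<le> n - a"
proof -
  obtain R S where \<mu>: "\<mu> = {R, S}" and RS: "R \<inter> S = {}" "R \<union> S = {1..2*n}"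
    "card (S \<inter> {1..n}) = n - a"
    using tableaux_of_type_rows[OF assms(1)] by metis
  define K where "K = {C\<in>\<nu>. C \<subseteq> {1..n}}"
  have \<nu>: "partition_on {1..2*n} \<nu>" "\<And>C. C \<in> \<nu> \<Longrightarrow> card C = 2" and k: "card K = k"
    using assms(2) unfolding vertical_tableaux_inner_def vertical_tableaux_def K_def by auto
  have "finite \<nu>" using \<nu>(1) by (meson finite_atLeastAtMost finite_elements)
  then have finK: "finite K" by (simp add: K_def)
  have meet: "1 \<le> card (C \<inter> S)" if "C \<in> K" for C
  proof -
    have C: "C \<in> \<nu>" "C \<subseteq> {1..n}" using that by (auto simp: K_def)
    have "C \<subseteq> R \<union> S" using C(2) RS(2) by auto
    then have "C = (R \<inter> C) \<union> (C \<inter> S)" by blast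
    then have "card C \<le> card (R \<inter> C) + card (C \<inter> S)" by (metis card_Un_le)
    moreover have "card (R \<inter> C) \<le> 1"
      using assms(3) C(1) \<mu> unfolding orthogonal_tableaux_def by simp
    ultimately show ?thesis using \<nu>(2)[OF C(1)] by simp
  qed
  have "k = (\<Sum>C\<in>K. 1)" using k by simp
  also have "\<dots> \<le> (\<Sum>C\<in>K. card (C \<inter> S))" using meet by (intro sum_mono) auto
  also have "\<dots> = card (\<Union>C\<in>K. C \<inter> S)"
  proof (rule card_UN_disjoint[symmetric])
    show "\<forall>C\<in>K. \<forall>D\<in>K. C \<noteq> D \<longrightarrow> (C \<inter> S) \<inter> (D \<inter> S) = {}"
      using \<nu>(1) unfolding partition_on_def disjoint_def K_def by auto
    show "\<forall>C\<in>K. finite (C \<inter> S)" unfolding K_def by (auto intro: finite_subset)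
  qed (rule finK)
  also have "\<dots> \<le> card (S \<inter> {1..n})"
    by (rule card_mono) (auto simp: K_def)
  finally show ?thesis using RS(3) by simp
qed

text \<open>The bound \<open>n - a\<close> is attained by matching the rows: all of
  \<open>S \<inter> {1..n}\<close> is paired with elements \<open>U\<close> of
  \<open>R \<inter> {1..n}\<close>, and the rest of \<open>R\<close> with the part of
  \<open>S\<close> outside \<open>{1..n}\<close>.\<close>

lemma exists_orthogonal_inner:
  assumes "\<mu> \<in> tableaux_of_type n a"
  obtains \<nu> where "\<nu> \<in> vertical_tableaux_inner n (n - a)" "\<mu> \<bottom>\<^sub>t \<nu>"
proof -
  obtain R S where \<mu>: "\<mu> = {R, S}" and RS: "R \<inter> S = {}" "R \<union> S = {1..2*n}" "card R = n" "card S = n"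
    "card (R \<inter> {1..n}) = a" "card (S \<inter> {1..n}) = n - a" "n - a \<le> a"
    using tableaux_of_type_rows[OF assms] by metis
  have fin: "finite R" "finite S" using RS(2) by (metis finite_Un finite_atLeastAtMost)+
  \<comment> \<open>There is room for \<open>U\<close> because \<open>n - a \<le> a\<close>.\<close>
  obtain U where U: "U \<subseteq> R \<inter> {1..n}" "card U = n - a"
    using obtain_subset_with_card_n[of "n - a" "R \<inter> {1..n}"] RS(5,7) by metis
  have finU: "finite U" using U(1) fin(1) by (meson finite_Int finite_subset)
  obtain f where f: "bij_betw f U (S \<inter> {1..n})"
    using finite_same_card_bij[of U "S \<inter> {1..n}"] finU U(2) RS(6) fin(2) by (metis finite_Int)
  have "card (R - U) = card (S - {1..n})"
    using card_Diff_subset[OF finU] card_Diff_subset_Int[of S "{1..n}"] U RS(3,4,6) fin(2)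
    by (metis finite_Int le_inf_iff)
  then obtain g where g: "bij_betw g (R - U) (S - {1..n})"
    using finite_same_card_bij[of "R - U" "S - {1..n}"] fin by auto
  define h where "h x = (if x \<in> U then f x else g x)" for x
  have hU: "bij_betw h U (S \<inter> {1..n})"
    using f by (rule bij_betw_cong[THEN iffD1, rotated]) (simp add: h_def)
  have hR: "bij_betw h (R - U) (S - {1..n})"
    using g by (rule bij_betw_cong[THEN iffD1, rotated]) (simp add: h_def)
  have h: "bij_betw h R S"
  proof -
    have "bij_betw h (U \<union> (R - U)) ((S \<inter> {1..n}) \<union> (S - {1..n}))"
      using hU hR by (rule bij_betw_combine) auto
    moreover have "U \<union> (R - U) = R" "(S \<inter> {1..n}) \<union> (S - {1..n}) = S" using U(1) by auto
    ultimately show ?thesis by simp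
  qed
  have hS: "h x \<in> S" if "x \<in> R" for x using h that by (rule bij_betw_apply)
  have hinj: "x = y" if "h x = h y" "x \<in> R" "y \<in> R" for x y
    using h that by (meson bij_betw_imp_inj_on inj_onD)
  define col where "col x = {x, h x}" for x
  have col_R: "R \<inter> col x = {x}" and col_S: "S \<inter> col x = {h x}" if "x \<in> R" for x
    using that hS[OF that] RS(1) by (auto simp: col_def)
  have inj: "inj_on col R" by (rule inj_onI) (metis col_R singleton_inject)
  \<comment> \<open>For \<open>x\<close> in \<open>R - U\<close> the partner \<open>h x\<close> lies
    outside \<open>{1..n}\<close>, even if \<open>x\<close> itself is inside; so exactly the columns
    starting in \<open>U\<close> are inner.\<close>
  have inU: "col x \<subseteq> {1..n} \<longleftrightarrow> x \<in> U" if "x \<in> R" for x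
    using that U(1) bij_betw_apply[OF hU, of x] bij_betw_apply[OF hR, of x] by (auto simp: col_def)
  have "partition_on {1..2*n} (col ` R)"
  proof (rule partition_onI)
    have "h ` R = S" using h by (rule bij_betw_imp_surj_on)
    then show "\<Union>(col ` R) = {1..2*n}" unfolding RS(2)[symmetric] col_def by auto
    show "disjnt p q" if "p \<in> col ` R" "q \<in> col ` R" "p \<noteq> q" for p q
      using that RS(1) hS hinj unfolding disjnt_def col_def by auto
  qed (auto simp: col_def)
  moreover have "card (col ` R) = n" using inj RS(3) by (simp add: card_image)
  moreover have "\<forall>C \<in> col ` R. card C = 2"
  proof
    fix C assume "C \<in> col ` R"
    then obtain x where x: "x \<in> R" "C = {x, h x}" by (auto simp: col_def)
    then have "x \<noteq> h x" using RS(1) hS[OF x(1)] by auto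
    then show "card C = 2" using x(2) by simp
  qed
  moreover have "{C \<in> col ` R. C \<subseteq> {1..n}} = col ` U" using inU U(1) by auto
  then have "card {C \<in> col ` R. C \<subseteq> {1..n}} = n - a"
    using inj_on_subset[OF inj, of U] U by (simp add: card_image)
  ultimately have "col ` R \<in> vertical_tableaux_inner n (n - a)"
    unfolding vertical_tableaux_inner_def vertical_tableaux_def by simp
  moreover have "\<mu> \<bottom>\<^sub>t col ` R"
    unfolding orthogonal_tableaux_def \<mu> by (auto simp: col_R col_S)
  ultimately show thesis by (rule that)
qed

section \<open>Splitting the sum by type and solving the triangular system\<close>

lemma sum_horizontal_tableaux_by_type:
  "(\<Sum>\<mu>\<in>horizontal_tableaux n. f \<mu>) = (\<Sum>a\<le>n. \<Sum>\<mu>\<in>tableaux_of_type n a. f \<mu>)"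
proof -
  have "tableau_type n \<mu> \<le> n" if "\<mu> \<in> horizontal_tableaux n" for \<mu>
    using that tableaux_of_type_rows[of \<mu> n "tableau_type n \<mu>"] unfolding tableaux_of_type_def
    by blast
  then show ?thesis
    unfolding tableaux_of_type_def
    by (intro sum.group[symmetric] finite_horizontal_tableaux) auto
qed

theorem theorem2p4:
  fixes n a :: nat and \<tau> :: "nat set set \<Rightarrow> complex"
  assumes "n \<ge> 1"
    and "\<And>\<nu>. \<nu> \<in> vertical_tableaux n \<Longrightarrow>
           (\<Sum>\<mu> \<in> {\<mu> \<in> horizontal_tableaux n. \<mu> \<bottom>\<^sub>t \<nu>}. \<tau> \<mu>) = 0"
    and "real n / 2 \<le> real a" and "a \<le> n"
  shows "(\<Sum>\<mu> \<in> tableaux_of_type n a. \<tau> \<mu>) = 0"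
  using \<open>a \<le> n\<close>
proof (induction a rule: less_induct)
  case (less a)
  \<comment> \<open>The equation for type \<open>a\<close> is the one with \<open>k = n - a\<close>,
    the largest \<open>k\<close> for which type \<open>a\<close> has a nonzero count.\<close>
  define N where "N \<mu> = card {\<nu> \<in> vertical_tableaux_inner n (n - a). \<mu> \<bottom>\<^sub>t \<nu>}" for \<mu>
  have N_const: "N \<mu> = N \<mu>'" if "\<mu> \<in> tableaux_of_type n b" "\<mu>' \<in> tableaux_of_type n b" for \<mu> \<mu>' b
    unfolding N_def using that by (intro antisym card_orthogonal_inner_le)
  show ?case
  proof (cases "tableaux_of_type n a = {}")
    case False
    then obtain \<mu>\<^sub>0 where \<mu>\<^sub>0: "\<mu>\<^sub>0 \<in> tableaux_of_type n a" by blast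
    \<comment> \<open>Smaller types vanish by the induction hypothesis, since \<open>N\<close> is
      constant on each type; for larger types \<open>b\<close> the count itself is zero, as at most
      \<open>n - b < n - a\<close> inner columns are possible.\<close>
    have off_diag: "(\<Sum>\<mu>\<in>tableaux_of_type n b. of_nat (N \<mu>) * \<tau> \<mu>) = 0" if "b \<le> n" "b \<noteq> a" for b
    proof (cases "b < a")
      case True
      show ?thesis
      proof (cases "tableaux_of_type n b = {}")
        case False
        then obtain \<mu>\<^sub>1 where "\<mu>\<^sub>1 \<in> tableaux_of_type n b" by blast
        then have "(\<Sum>\<mu>\<in>tableaux_of_type n b. of_nat (N \<mu>) * \<tau> \<mu>)
            = of_nat (N \<mu>\<^sub>1) * (\<Sum>\<mu>\<in>tableaux_of_type n b. \<tau> \<mu>)"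
          unfolding sum_distrib_left by (intro sum.cong refl) (metis N_const)
        then show ?thesis using less.IH[OF True \<open>b \<le> n\<close>] by simp
      qed simp
    next
      case False
      then have "n - b < n - a" using that by simp
      then have "{\<nu> \<in> vertical_tableaux_inner n (n - a). \<mu> \<bottom>\<^sub>t \<nu>} = {}"
        if "\<mu> \<in> tableaux_of_type n b" for \<mu>
        using inner_columns_le[OF that] by (auto simp: not_le[symmetric])
      then have "N \<mu> = 0" if "\<mu> \<in> tableaux_of_type n b" for \<mu>
        using that unfolding N_def by (metis card.empty)
      then show ?thesis by simp
    qed
    have "0 = (\<Sum>\<nu>\<in>vertical_tableaux_inner n (n - a).
        \<Sum>\<mu> \<in> {\<mu> \<in> horizontal_tableaux n. \<mu> \<bottom>\<^sub>t \<nu>}. \<tau> \<mu>)"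
      using assms(2) by (simp add: vertical_tableaux_inner_def)
    \<comment> \<open>Double counting of orthogonal pairs: each \<tau> \<mu> now appears once for
      every \<nu> counted by \<open>N \<mu>\<close>.\<close>
    also have "\<dots> = (\<Sum>\<mu>\<in>horizontal_tableaux n.
        \<Sum>\<nu> \<in> {\<nu> \<in> vertical_tableaux_inner n (n - a). \<mu> \<bottom>\<^sub>t \<nu>}. \<tau> \<mu>)"
      by (intro sum.swap_restrict finite_vertical_tableaux_inner finite_horizontal_tableaux)
    also have "\<dots> = (\<Sum>\<mu>\<in>horizontal_tableaux n. of_nat (N \<mu>) * \<tau> \<mu>)"
      by (simp add: N_def)
    also have "\<dots> = (\<Sum>b\<le>n. \<Sum>\<mu>\<in>tableaux_of_type n b. of_nat (N \<mu>) * \<tau> \<mu>)"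
      by (rule sum_horizontal_tableaux_by_type)
    also have "\<dots> = (\<Sum>\<mu>\<in>tableaux_of_type n a. of_nat (N \<mu>) * \<tau> \<mu>)"
      using less.prems off_diag by (subst sum.remove[of _ a]) auto
    also have "\<dots> = of_nat (N \<mu>\<^sub>0) * (\<Sum>\<mu>\<in>tableaux_of_type n a. \<tau> \<mu>)"
      unfolding sum_distrib_left using \<mu>\<^sub>0 by (intro sum.cong refl) (metis N_const)
    finally have "of_nat (N \<mu>\<^sub>0) * (\<Sum>\<mu>\<in>tableaux_of_type n a. \<tau> \<mu>) = 0" by simp
    \<comment> \<open>The diagonal coefficient is nonzero thanks to the matching constructed above,
      so it can be cancelled.\<close>
    moreover have "N \<mu>\<^sub>0 \<noteq> 0"
      using exists_orthogonal_inner[OF \<mu>\<^sub>0] finite_vertical_tableaux_inner[of n "n - a"]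
      unfolding N_def by (auto simp: card_eq_0_iff)
    ultimately show ?thesis by simp
  qed simp
qed

end
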